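(* Let $X$ be a metric space. If $X$ has the asymptotic property C, then $X$ has straight finite decomposition complexity (sFDC).
   Context: For nonempty subsets $A,B$ of a metric space put $d(A,B)=\inf\{d(a,b)\mid a\in A,\ b\in B\}$. For $R>0$, a family $\mathcal A$ of nonempty subsets of a metric space is $R$-disjoint if $d(A,B)>R$ for all distinct $A,B\in\mathcal A$. A metric family is a family (set) of metric spaces; subsets of a metric space are regarded as metric spaces with the restricted metric. Asymptotic property C: A metric space $X$ has the asymptotic property C if for every sequence $R_1<R_2<\cdots$ of positive numbers there exist $n\in\mathbb N$ and families $\mathcal U_1,\dots,\mathcal U_n$ of subsets of $X$ such that each $\mathcal U_i$ is uniformly bounded (the diameters of its members have a finite common upper bound) and $R_i$-disjoint, and $\bigcup_{i=1}^n\mathcal U_i$ is a cover of $X$. Let $\mathcal X,\mathcal Y$ be metric families and $R>0$. $\mathcal X$ is $R$-decomposable over $\mathcal Y$ if for every $X\in\mathcal X$ there are $R$-disjoint families $\mathcal V_1,\mathcal V_2$ of subsets of $X$ with $X=\bigcup(\mathcal V_1\cup\mathcal V_2)$ and $\mathcal V_1\cup\mathcal V_2\subset\mathcal Y$. A metric family $\mathcal X$ is bounded if $\sup\{\mathrm{diam}\,X\mid X\in\mathcal X\}<\infty$. sFDC: A metric space $X$ has sFDC if for every sequence $R_1<R_2<\cdots$ of positive numbers there exist $n\in\mathbb N$ and metric families $\mathcal V_1,\dots,\mathcal V_n$ such that $\{X\}$ is $R_1$-decomposable over $\mathcal V_1$, $\mathcal V_i$ is $R_{i+1}$-decomposable over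 $\mathcal V_{i+1}$ for $i=1,\dots,n-1$, and $\mathcal V_n$ is bounded. *)

theory Defs
  imports "HOL-Analysis.Analysis"
begin

text \<open>
  Metric spaces are values of the library type \<^typ>\<open>'a metric\<close> (carrier \<^const>\<open>mspace\<close>, distance
  \<^const>\<open>mdist\<close>), so a metric family is a set of type \<^typ>\<open>'a metric set\<close>, and a subset of a metric
  space becomes a member of such a family through \<^const>\<open>submetric\<close>.
\<close>

text \<open>The real infimum is only meaningful for nonempty sets; \<open>R_disjoint\<close> below requires this.\<close>

definition set_mdist :: "'a metric \<Rightarrow> 'a set \<Rightarrow> 'a set \<Rightarrow> real" where
  "set_mdist X A B = Inf {mdist X a b |a b. a \<in> A \<and> b \<in> B}"

text \<open>
  Diameters are extended nonnegative reals, so that unbounded sets have diameter \<open>\<infinity>\<close>;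
  the empty set has diameter \<open>0\<close>.
\<close>

definition set_mdiam :: "'a metric \<Rightarrow> 'a set \<Rightarrow> ennreal" where
  "set_mdiam X A = (SUP (a, b)\<in>A \<times> A. ennreal (mdist X a b))"

definition R_disjoint :: "'a metric \<Rightarrow> real \<Rightarrow> 'a set set \<Rightarrow> bool" where
  "R_disjoint X R \<A> \<longleftrightarrow>
     (\<forall>A\<in>\<A>. A \<noteq> {} \<and> A \<subseteq> mspace X) \<and>
     (\<forall>A\<in>\<A>. \<forall>B\<in>\<A>. A \<noteq> B \<longrightarrow> set_mdist X A B > R)"

definition uniformly_bounded :: "'a metric \<Rightarrow> 'a set set \<Rightarrow> bool" where
  "uniformly_bounded X \<U> \<longleftrightarrow> (\<exists>D::real. \<forall>U\<in>\<U>. set_mdiam X U \<le> ennreal D)"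

text \<open>Sequences are indexed from \<open>1\<close>; the value at index \<open>0\<close> is irrelevant.\<close>

definition scale_sequence :: "(nat \<Rightarrow> real) \<Rightarrow> bool" where
  "scale_sequence R \<longleftrightarrow> (\<forall>i\<ge>1. 0 < R i) \<and> strict_mono_on {1..} R"

definition asymptotic_property_C :: "'a metric \<Rightarrow> bool" where
  "asymptotic_property_C X \<longleftrightarrow>
     (\<forall>R. scale_sequence R \<longrightarrow>
        (\<exists>n\<ge>1. \<exists>\<U> :: nat \<Rightarrow> 'a set set.
           (\<forall>i\<in>{1..n}. \<U> i \<subseteq> Pow (mspace X) \<and> uniformly_bounded X (\<U> i) \<and> R_disjoint X (R i) (\<U> i)) \<and>
           \<Union>(\<Union>i\<in>{1..n}. \<U> i) = mspace X))"

definition R_decomposable :: "real \<Rightarrow> 'a metric set \<Rightarrow> 'a metric set \<Rightarrow> bool" where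
  "R_decomposable R \<X> \<Y> \<longleftrightarrow>
     (\<forall>X\<in>\<X>. \<exists>\<V>1 \<V>2. \<V>1 \<subseteq> Pow (mspace X) \<and> \<V>2 \<subseteq> Pow (mspace X) \<and>
        R_disjoint X R \<V>1 \<and> R_disjoint X R \<V>2 \<and>
        mspace X = \<Union>(\<V>1 \<union> \<V>2) \<and>
        submetric X ` (\<V>1 \<union> \<V>2) \<subseteq> \<Y>)"

definition bounded_family :: "'a metric set \<Rightarrow> bool" where
  "bounded_family \<X> \<longleftrightarrow> (SUP X\<in>\<X>. set_mdiam X (mspace X)) < \<infinity>"

definition sFDC :: "'a metric \<Rightarrow> bool" where
  "sFDC X \<longleftrightarrow>
     (\<forall>R. scale_sequence R \<longrightarrow>
        (\<exists>n\<ge>1. \<exists>\<V> :: nat \<Rightarrow> 'a metric set.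
           R_decomposable (R 1) {X} (\<V> 1) \<and>
           (\<forall>i\<in>{1..<n}. R_decomposable (R (i + 1)) (\<V> i) (\<V> (i + 1))) \<and>
           bounded_family (\<V> n)))"

end

theory Submission
  imports Defs
begin

text \<open>
  Apply property C to the given scales and peel off one cover family at a time: at step \<open>i\<close> the
  part of \<open>X\<close> not yet covered by \<open>\<U> 1, \<dots>, \<U> (i - 1)\<close> is split into its traces on the members of \<open>\<U> i\<close>
  and the remaining uncovered part, while the pieces split off earlier stay whole. After \<open>n\<close> steps nothing
  is left uncovered, so only uniformly bounded pieces remain.
\<close>

text \<open>Fewer pairs of points compete in the infimum for the smaller sets. These must be
  nonempty, because the real \<open>Inf\<close> of the empty set carries no information.\<close>

lemma set_mdist_mono:
  assumes "A' \<subseteq> A" "B' \<subseteq> B" "A' \<noteq> {}" "B' \<noteq> {}"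
  shows "set_mdist X A B \<le> set_mdist X A' B'"
  unfolding set_mdist_def
proof (rule cInf_superset_mono)
  show "bdd_below {mdist X a b |a b. a \<in> A \<and> b \<in> B}"
    by (rule bdd_belowI[of _ 0]) auto
qed (use assms in auto)

lemma set_mdiam_mono: "A \<subseteq> B \<Longrightarrow> set_mdiam X A \<le> set_mdiam X B"
  unfolding set_mdiam_def by (rule SUP_subset_mono) auto

lemma set_mdist_submetric [simp]: "set_mdist (submetric X S) = set_mdist X"
  by (simp add: set_mdist_def fun_eq_iff)

lemma set_mdiam_submetric [simp]: "set_mdiam (submetric X S) = set_mdiam X"
  by (simp add: set_mdiam_def fun_eq_iff)

lemma Union_Diff_empty: "\<Union>(\<A> - {{}}) = \<Union>\<A>"
  by blast

lemma R_disjoint_empty [simp]: "R_disjoint X R {}"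
  by (simp add: R_disjoint_def)

text \<open>Members of an \<open>R_disjoint\<close> family must be nonempty, so a single piece that
  may be empty enters a decomposition as \<open>{A} - {{}}\<close>. There are no two distinct
  members to compare.\<close>

lemma R_disjoint_nonempty_subsingleton: "A \<subseteq> mspace X \<Longrightarrow> R_disjoint X R ({A} - {{}})"
  by (auto simp: R_disjoint_def)

lemma R_disjoint_submetric:
  "R_disjoint (submetric X S) R \<A> \<longleftrightarrow> R_disjoint X R \<A> \<and> \<Union>\<A> \<subseteq> S"
  by (auto simp: R_disjoint_def)

text \<open>Distinct traces come from distinct members of \<open>\<U>\<close>, and shrinking two
  sets to nonempty subsets cannot bring them closer.\<close>

lemma R_disjoint_trace:
  assumes "R_disjoint X R \<U>"
  shows "R_disjoint X R ((\<lambda>U. U \<inter> S) ` \<U> - {{}})"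
  unfolding R_disjoint_def
proof (intro conjI ballI impI)
  fix A B assume A: "A \<in> (\<lambda>U. U \<inter> S) ` \<U> - {{}}" and B: "B \<in> (\<lambda>U. U \<inter> S) ` \<U> - {{}}" and "A \<noteq> B"
  from A B obtain U V where UV: "U \<in> \<U>" "A = U \<inter> S" "V \<in> \<U>" "B = V \<inter> S" by auto
  with \<open>A \<noteq> B\<close> assms have "R < set_mdist X U V" by (auto simp: R_disjoint_def)
  also have "\<dots> \<le> set_mdist X A B"
    using A B UV by (intro set_mdist_mono) auto
  finally show "R < set_mdist X A B" .
qed (use assms in \<open>auto simp: R_disjoint_def\<close>)

text \<open>Reduces decompositions of subspaces to statements about subsets of the one ambient space
  \<open>X\<close>: distances are inherited, and a subspace of a subspace is a subspace of
  \<open>X\<close>.\<close>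

lemma R_decomposable_submetrics:
  assumes "\<And>S. S \<in> \<S> \<Longrightarrow> S \<subseteq> mspace X"
    and "\<And>S. S \<in> \<S> \<Longrightarrow> \<exists>\<V>1 \<V>2. R_disjoint X R \<V>1 \<and> R_disjoint X R \<V>2 \<and>
           S = \<Union>(\<V>1 \<union> \<V>2) \<and> \<V>1 \<union> \<V>2 \<subseteq> \<T>"
  shows "R_decomposable R (submetric X ` \<S>) (submetric X ` \<T>)"
  unfolding R_decomposable_def
proof
  fix Z assume "Z \<in> submetric X ` \<S>"
  then obtain S where S: "S \<in> \<S>" and Z: "Z = submetric X S" by auto
  obtain \<V>1 \<V>2 where V: "R_disjoint X R \<V>1" "R_disjoint X R \<V>2"
      "S = \<Union>(\<V>1 \<union> \<V>2)" "\<V>1 \<union> \<V>2 \<subseteq> \<T>"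
    using assms(2)[OF S] by blast
  have mZ: "mspace Z = S" using assms(1)[OF S] Z by auto
  have "submetric Z W = submetric X W" if "W \<in> \<V>1 \<union> \<V>2" for W
  proof -
    have "S \<inter> W = W" using that V(3) by auto
    then show ?thesis by (simp add: Z submetric_submetric)
  qed
  then have "submetric Z ` (\<V>1 \<union> \<V>2) \<subseteq> submetric X ` \<T>"
    using V(4) by auto
  moreover have "R_disjoint Z R \<V>1" "R_disjoint Z R \<V>2"
    using V by (auto simp: Z R_disjoint_submetric)
  moreover have "\<V>1 \<subseteq> Pow (mspace Z)" "\<V>2 \<subseteq> Pow (mspace Z)" "mspace Z = \<Union>(\<V>1 \<union> \<V>2)"
    unfolding mZ using V(3) by auto
  ultimately show "\<exists>\<V>1 \<V>2. \<V>1 \<subseteq> Pow (mspace Z) \<and> \<V>2 \<subseteq> Pow (mspace Z) \<and>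
        R_disjoint Z R \<V>1 \<and> R_disjoint Z R \<V>2 \<and> mspace Z = \<Union>(\<V>1 \<union> \<V>2) \<and>
        submetric Z ` (\<V>1 \<union> \<V>2) \<subseteq> submetric X ` \<T>"
    by blast
qed

definition uncovered :: "'a metric \<Rightarrow> (nat \<Rightarrow> 'a set set) \<Rightarrow> nat \<Rightarrow> 'a set" where
  "uncovered X \<U> i = mspace X - \<Union>(\<Union>j\<in>{1..i}. \<U> j)"

text \<open>
  All subsets of the cover members are admitted, not just the traces that actually occur; this
  keeps the family closed under the splitting and changes no diameter bound.
\<close>

definition peeling :: "'a metric \<Rightarrow> (nat \<Rightarrow> 'a set set) \<Rightarrow> nat \<Rightarrow> 'a set set" where
  "peeling X \<U> i = insert (uncovered X \<U> i) (\<Union>j\<in>{1..i}. \<Union>U\<in>\<U> j. Pow U)"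

lemma submetric_peeling_0: "submetric X ` peeling X \<U> 0 = {X}"
  by (simp add: peeling_def uncovered_def submetric_mspace)

lemma R_decomposable_peeling:
  assumes sub: "\<And>j. j \<in> {1..Suc i} \<Longrightarrow> \<U> j \<subseteq> Pow (mspace X)"
    and disj: "R_disjoint X R (\<U> (Suc i))"
  shows "R_decomposable R (submetric X ` peeling X \<U> i) (submetric X ` peeling X \<U> (Suc i))"
proof (rule R_decomposable_submetrics)
  fix S assume S: "S \<in> peeling X \<U> i"
  show S_sub: "S \<subseteq> mspace X"
    using S sub by (fastforce simp: peeling_def uncovered_def)
  consider (piece) j U where "j \<in> {1..i}" "U \<in> \<U> j" "S \<subseteq> U" | (rest) "S = uncovered X \<U> i"
    using S by (auto simp: peeling_def)
  then show "\<exists>\<V>1 \<V>2. R_disjoint X R \<V>1 \<and> R_disjoint X R \<V>2 \<and>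
      S = \<Union>(\<V>1 \<union> \<V>2) \<and> \<V>1 \<union> \<V>2 \<subseteq> peeling X \<U> (Suc i)"
  proof cases
    case piece
    then have "S \<in> peeling X \<U> (Suc i)"
      unfolding peeling_def by force
    \<comment> \<open>An old piece is decomposed trivially: the first family holds only
      \<open>S\<close>, or nothing if \<open>S\<close> is empty, and the second is empty.\<close>
    then show ?thesis
      using R_disjoint_nonempty_subsingleton[OF S_sub]
      by (intro exI[of _ "{S} - {{}}"] exI[of _ "{}"]) auto
  next
    case rest
    \<comment> \<open>The disjointness of \<open>\<U> (Suc i)\<close> passes to the traces in
      \<open>\<V>1\<close>; what they miss of \<open>S\<close> is the next uncovered set, placed
      alone in \<open>\<V>2\<close>.\<close>
    define \<V>1 where "\<V>1 = (\<lambda>U. U \<inter> S) ` \<U> (Suc i) - {{}}"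
    define \<V>2 where "\<V>2 = {uncovered X \<U> (Suc i)} - {{}}"
    have eq: "uncovered X \<U> (Suc i) = S - \<Union>(\<U> (Suc i))"
      by (auto simp: rest uncovered_def atLeastAtMostSuc_conv)
    have "R_disjoint X R \<V>1"
      unfolding \<V>1_def by (rule R_disjoint_trace[OF disj])
    moreover have "R_disjoint X R \<V>2"
      unfolding \<V>2_def by (rule R_disjoint_nonempty_subsingleton) (simp add: uncovered_def)
    moreover have "S = \<Union>(\<V>1 \<union> \<V>2)"
    proof -
      have "\<Union>(\<V>1 \<union> \<V>2) = (\<Union>U\<in>\<U> (Suc i). U \<inter> S) \<union> (S - \<Union>(\<U> (Suc i)))"
        unfolding \<V>1_def \<V>2_def eq Union_Un_distrib Union_Diff_empty by simp
      then show ?thesis by blast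
    qed
    moreover have "\<V>1 \<subseteq> peeling X \<U> (Suc i)"
      unfolding \<V>1_def peeling_def by force
    moreover have "\<V>2 \<subseteq> peeling X \<U> (Suc i)"
      unfolding \<V>2_def peeling_def by auto
    ultimately show ?thesis
      by (intro exI[of _ \<V>1] exI[of _ \<V>2]) simp
  qed
qed

text \<open>With nothing uncovered, every nonempty member lies in some cover member. The bounds of
  the \<open>n\<close> families are combined into one by summing them, as \<open>ennreal\<close>
  terms are nonnegative.\<close>

lemma bounded_family_peeling:
  assumes cover: "uncovered X \<U> n = {}"
    and bdd: "\<And>i. i \<in> {1..n} \<Longrightarrow> uniformly_bounded X (\<U> i)"
  shows "bounded_family (submetric X ` peeling X \<U> n)"
proof -
  obtain D where D: "\<And>i U. i \<in> {1..n} \<Longrightarrow> U \<in> \<U> i \<Longrightarrow> set_mdiam X U \<le> ennreal (D i)"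
    using bdd unfolding uniformly_bounded_def by metis
  \<comment> \<open>\<open>S \<inter> mspace X\<close> is the carrier of
    \<open>submetric X S\<close>.\<close>
  have "set_mdiam X (S \<inter> mspace X) \<le> (\<Sum>i=1..n. ennreal (D i))" if S: "S \<in> peeling X \<U> n" for S
  proof -
    consider "S = {}" | i U where "i \<in> {1..n}" "U \<in> \<U> i" "S \<subseteq> U"
      using S cover by (auto simp: peeling_def)
    then show ?thesis
    proof cases
      case 1
      then show ?thesis by (simp add: set_mdiam_def bot_ennreal)
    next
      case 2
      have "set_mdiam X (S \<inter> mspace X) \<le> set_mdiam X U"
        using 2 by (intro set_mdiam_mono) auto
      also have "\<dots> \<le> ennreal (D i)" using 2 D by blast
      also have "\<dots> \<le> (\<Sum>i=1..n. ennreal (D i))"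
        using 2 by (intro member_le_sum) auto
      finally show ?thesis .
    qed
  qed
  then have "(SUP Z\<in>submetric X ` peeling X \<U> n. set_mdiam Z (mspace Z)) \<le> (\<Sum>i=1..n. ennreal (D i))"
    by (auto intro!: SUP_least)
  also have "\<dots> < \<infinity>" by simp
  finally show ?thesis unfolding bounded_family_def .
qed

theorem proposition3p2:
  fixes X :: "'a metric"
  assumes "asymptotic_property_C X"
  shows "sFDC X"
  unfolding sFDC_def
proof (intro allI impI)
  fix R :: "nat \<Rightarrow> real" assume R: "scale_sequence R"
  obtain n \<U> where n: "n \<ge> 1"
    and all: "\<forall>i\<in>{1..n}. \<U> i \<subseteq> Pow (mspace X) \<and> uniformly_bounded X (\<U> i) \<and> R_disjoint X (R i) (\<U> i)"
    and cover: "\<Union>(\<Union>i\<in>{1..n}. \<U> i) = mspace X"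
    using assms[unfolded asymptotic_property_C_def, rule_format, of R, OF R] by (elim exE conjE) iprover
  have U: "\<U> i \<subseteq> Pow (mspace X)" "uniformly_bounded X (\<U> i)" "R_disjoint X (R i) (\<U> i)"
    if "i \<in> {1..n}" for i
    using all that by blast+
  define \<V> where "\<V> i = submetric X ` peeling X \<U> i" for i
  \<comment> \<open>Passing from stage \<open>i\<close> to stage \<open>Suc i\<close> consumes
    \<open>\<U> (Suc i)\<close>, which is disjoint at scale \<open>R (Suc i)\<close>. Starting at
    stage \<open>0\<close>, where the family is \<open>{X}\<close>, makes the indices agree with
    those in \<open>sFDC\<close>.\<close>
  have step: "R_decomposable (R (Suc i)) (\<V> i) (\<V> (Suc i))" if "i < n" for i
    unfolding \<V>_def using that U by (intro R_decomposable_peeling) auto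
  have "R_decomposable (R 1) {X} (\<V> 1)"
    using step[of 0] n by (simp add: \<V>_def submetric_peeling_0)
  moreover have "\<forall>i\<in>{1..<n}. R_decomposable (R (i + 1)) (\<V> i) (\<V> (i + 1))"
    using step by simp
  moreover have "bounded_family (\<V> n)"
    unfolding \<V>_def using U(2) cover by (intro bounded_family_peeling) (auto simp: uncovered_def)
  ultimately show "\<exists>n\<ge>1. \<exists>\<V> :: nat \<Rightarrow> 'a metric set. R_decomposable (R 1) {X} (\<V> 1) \<and>
      (\<forall>i\<in>{1..<n}. R_decomposable (R (i + 1)) (\<V> i) (\<V> (i + 1))) \<and> bounded_family (\<V> n)"
    using n by blast
qed

end
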